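(* Let $P$ be a non-uniform probability distribution on a finite set and let $Q=U_l$ be the uniform distribution on $l\ge2$ elements. For all $s_2,t_2\in\mathbb R$, $F^{\mathcal D}_{P,U_l,s_2}(t_2)=F^{\mathcal M}_{P,U_l,s_2}(t_2)$, and the common value $F_{P,U_l,s_2}(t_2)$ is $$F_{P,U_l,s_2}(t_2)=\begin{cases}\sqrt{\Phi\left(\frac{-\log l}{\sqrt{V(P)}}\,t_2\right)} & \text{if }(\log l)\,t_2\le s_2,\\[1mm] 0&\text{otherwise.}\end{cases}$$ In particular, $F_{P,U_l,s_2}(t_2)=\sqrt{1-Z_{0,\frac{s_2}{\sqrt{V(P)}}}(t_2D_{P,U_l})}$.
   Context: All logarithms are to base $2$. $\Phi$ is the standard normal cumulative distribution function. $\mathcal P(\mathcal X)$ is the set of probability distributions on a finite set $\mathcal X$; $P^n$ is the $n$-fold i.i.d. product. $H(P)=-\sum_x P(x)\log P(x)$, $V(P)=\sum_x P(x)(-\log P(x)-H(P))^2$. Non-uniform means not uniform on its support, i.e. $V(P)>0$. $D_{P,Q}=\frac{H(Q)}{\sqrt{V(P)}}$. For $s\in\mathbb R$, $Z_{0,s}(\mu)=\Phi(\mu)$ if $\mu\le s$ and $Z_{0,s}(\mu)=1$ if $\mu>s$. For a map $f:\mathcal X\to\mathcal Y$, $W_f(P)(y)=\sum_{x\in f^{-1}(y)}P(x)$. Fidelity: $F(Q,Q')=\sum_y\sqrt{Q(y)}\sqrt{Q'(y)}$. $P^{\downarrow}_i$ is the $i$-th largest value of $P$ (and $0$ beyond the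 size of the set). $P\prec Q$ means $\sum_{i=1}^k P^{\downarrow}_i\le\sum_{i=1}^k Q^{\downarrow}_i$ for all $k$ (the finite sets may differ). A storage of $N$ bits is $K_N=\{0,1\}^N$; for real $N\ge0$ it is a set of $\lfloor 2^N\rfloor$ elements. A real exponent $Q^t$ means $Q^{\lfloor t\rfloor}$. For $P\in\mathcal P(\mathcal X)$, $Q\in\mathcal P(\mathcal Y)$, $F^{\mathcal D}(P\to Q|N)=\sup_{f:\mathcal X\to K_N,\ f':K_N\to\mathcal Y}F(W_{f'}\circ W_f(P),Q)$ and $F^{\mathcal M}(P\to Q|N)=\sup\{F(P'',Q)\mid P''\in\mathcal P(\mathcal Y),\ \exists P'\in\mathcal P(K_N):\ P\prec P'\prec P''\}$. For $i\in\{\mathcal D,\mathcal M\}$, $F^i_{P,Q,s_2}(t_2)=\liminf_{n\to\infty}F^i\big(P^n\to Q^{\frac{H(P)}{H(Q)}n+t_2\sqrt n}\,\big|\,H(P)n+s_2\sqrt n\big)$ (only large $n$ matter). *)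

theory Defs
  imports "HOL-Probability.Probability"
begin

text \<open>
  A distribution on a finite set \<open>X\<close> is a \<open>pmf\<close> whose support is contained in the explicit
  carrier \<open>X\<close>. The pushforward \<open>W\<^sub>f(P)\<close> along \<open>f\<close> is \<^const>\<open>map_pmf\<close>, and the
  i.i.d. product \<open>P\<^sup>n\<close> on \<open>X\<^sup>n\<close> is \<^const>\<open>replicate_pmf\<close> on the words of length
  \<open>n\<close> over \<open>X\<close>. All logarithms are to base 2.
\<close>

definition dists :: "'a set \<Rightarrow> 'a pmf set" where
  "dists X = {P. set_pmf P \<subseteq> X}"

definition words :: "'a set \<Rightarrow> nat \<Rightarrow> 'a list set" where
  "words X n = {xs. length xs = n \<and> set xs \<subseteq> X}"

definition non_uniform :: "'a pmf \<Rightarrow> bool" where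
  "non_uniform P \<longleftrightarrow> P \<noteq> pmf_of_set (set_pmf P)"

text \<open>In the next two sums the convention \<open>0 log 0 = 0\<close> holds because the factor \<open>pmf P x\<close>
  vanishes.\<close>

definition shannon_entropy :: "'a set \<Rightarrow> 'a pmf \<Rightarrow> real" where
  "shannon_entropy X P = - (\<Sum>x\<in>X. pmf P x * log 2 (pmf P x))"

definition varentropy :: "'a set \<Rightarrow> 'a pmf \<Rightarrow> real" where
  "varentropy X P = (\<Sum>x\<in>X. pmf P x * (- log 2 (pmf P x) - shannon_entropy X P)\<^sup>2)"

definition Phi :: "real \<Rightarrow> real" where
  "Phi = cdf std_normal_distribution"

definition D_ratio :: "'a set \<Rightarrow> 'a pmf \<Rightarrow> 'b set \<Rightarrow> 'b pmf \<Rightarrow> real" where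
  "D_ratio X P Y Q = shannon_entropy Y Q / sqrt (varentropy X P)"

definition Z0 :: "real \<Rightarrow> real \<Rightarrow> real" where
  "Z0 s \<mu> = (if \<mu> \<le> s then Phi \<mu> else 1)"

definition fidelity :: "'b set \<Rightarrow> 'b pmf \<Rightarrow> 'b pmf \<Rightarrow> real" where
  "fidelity Y Q Q' = (\<Sum>y\<in>Y. sqrt (pmf Q y) * sqrt (pmf Q' y))"

text \<open>The \<open>i\<close>-th largest value, counting from \<open>i = 1\<close> and with multiplicity.\<close>

definition decr :: "'a set \<Rightarrow> 'a pmf \<Rightarrow> nat \<Rightarrow> real" where
  "decr X P i =
     (if 1 \<le> i \<and> i \<le> card X
      then rev (sorted_list_of_multiset (image_mset (pmf P) (mset_set X))) ! (i - 1)
      else 0)"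

definition majorized :: "'a set \<Rightarrow> 'a pmf \<Rightarrow> 'b set \<Rightarrow> 'b pmf \<Rightarrow> bool" where
  "majorized X P Y Q \<longleftrightarrow> (\<forall>k::nat. (\<Sum>i=1..k. decr X P i) \<le> (\<Sum>i=1..k. decr Y Q i))"

text \<open>A storage of \<open>N\<close> bits, up to labelling. For \<open>N < 0\<close> it is empty, and the suprema
  below are then meaningless; in the limit taken in \<open>second_order_fidelity\<close> this concerns only
  finitely many \<open>n\<close>.\<close>

definition storage :: "real \<Rightarrow> nat set" where
  "storage N = {..<nat \<lfloor>2 powr N\<rfloor>}"

definition fidelity_det ::
    "'a set \<Rightarrow> 'a pmf \<Rightarrow> 'b set \<Rightarrow> 'b pmf \<Rightarrow> real \<Rightarrow> real" where
  "fidelity_det X P Y Q N =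
     (SUP (f, f') \<in> (X \<rightarrow> storage N) \<times> (storage N \<rightarrow> Y). fidelity Y (map_pmf f' (map_pmf f P)) Q)"

definition fidelity_maj ::
    "'a set \<Rightarrow> 'a pmf \<Rightarrow> 'b set \<Rightarrow> 'b pmf \<Rightarrow> real \<Rightarrow> real" where
  "fidelity_maj X P Y Q N =
     (SUP P'' \<in> {P'' \<in> dists Y. \<exists>P' \<in> dists (storage N).
                     majorized X P (storage N) P' \<and> majorized (storage N) P' Y P''}.
        fidelity Y P'' Q)"

text \<open>The argument \<open>F\<close> is \<^const>\<open>fidelity_det\<close> or \<^const>\<open>fidelity_maj\<close>. The lower limit is
  taken in the extended reals. \<open>m\<close> is the rounded exponent of \<open>Q\<close>; it is truncated at 0 only
  for finitely many \<open>n\<close>.\<close>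

definition second_order_fidelity ::
    "('a list set \<Rightarrow> 'a list pmf \<Rightarrow> 'b list set \<Rightarrow> 'b list pmf \<Rightarrow> real \<Rightarrow> real) \<Rightarrow>
     'a set \<Rightarrow> 'a pmf \<Rightarrow> 'b set \<Rightarrow> 'b pmf \<Rightarrow> real \<Rightarrow> real \<Rightarrow> ereal" where
  "second_order_fidelity F X P Y Q s t =
     liminf (\<lambda>n. ereal (
       let m = nat \<lfloor>shannon_entropy X P / shannon_entropy Y Q * real n + t * sqrt (real n)\<rfloor>
       in F (words X n) (replicate_pmf n P) (words Y m) (replicate_pmf m Q)
            (shannon_entropy X P * real n + s * sqrt (real n))))"

end

theory Submission
  imports Defs "HOL-Real_Asymp.Real_Asymp"
begin

text \<open>
  Every deterministic conversion induces a majorization chain, so it suffices to bound the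
  majorization fidelity from above and the deterministic one from below. Let \<open>M = l\<^sup>m\<close> be the
  number of target words and \<open>K\<close> the storage size.

  If \<open>(log l) t > s\<close>, any distribution obtained through the storage is carried by \<open>K\<close> words, so
  its fidelity with the uniform distribution is at most \<open>sqrt (K / M)\<close>, which tends to 0.

  Otherwise \<open>M \<le> K\<close> and the storage imposes no constraint. The words with \<open>P\<^sup>n\<close>-probability at
  least \<open>n / M\<close> number at most \<open>M / n\<close>; by majorization, their total mass is forced onto a
  vanishing fraction of the target words and contributes nothing to the fidelity. Conversely, the
  words with probability at most \<open>1 / (n M)\<close> can be distributed greedily and almost evenly over
  all \<open>M\<close> target words. As the factors \<open>n\<close> only shift the threshold for \<open>- log P\<^sup>n\<close> by
  \<open>log n = o(sqrt n)\<close>, the central limit theorem gives both sets of words complementary limiting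
  probabilities.
\<close>

section \<open>Central limit theorem for words\<close>

text \<open>Induction on the first letter: a word of length \<open>Suc n\<close> is a letter
  followed by an independent word, and the exponential of the sum factors accordingly.\<close>

lemma char_distr_replicate_pmf:
  fixes p :: "'a pmf" and g :: "'a \<Rightarrow> real"
  assumes "finite (set_pmf p)"
  shows "char (distr (measure_pmf (replicate_pmf n p)) borel (\<lambda>xs. sum_list (map g xs))) t
    = char (distr (measure_pmf p) borel g) t ^ n"
proof (induction n)
  case 0
  then show ?case by (simp add: char_def integral_distr)
next
  case (Suc n)
  have fin: "finite (set_pmf (replicate_pmf n p))"
    unfolding set_replicate_pmf
    using assms finite_lists_length_eq[of "set_pmf p" n] by (simp add: lists_eq_set conj_commute)
  have "char (distr (measure_pmf (replicate_pmf (Suc n) p)) borel (\<lambda>xs. sum_list (map g xs))) t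
     = measure_pmf.expectation (replicate_pmf (Suc n) p) (\<lambda>xs. iexp (t * sum_list (map g xs)))"
    by (simp add: char_def integral_distr del: replicate_pmf.simps)
  also have "\<dots> = (\<Sum>x\<in>set_pmf p. pmf p x *\<^sub>R
      measure_pmf.expectation (map_pmf (\<lambda>xs. x # xs) (replicate_pmf n p)) (\<lambda>xs. iexp (t * sum_list (map g xs))))"
    using assms fin
    by (simp add: pmf_expectation_bind[where A="set_pmf p"] map_pmf_def)
  also have "\<dots> = (\<Sum>x\<in>set_pmf p. pmf p x *\<^sub>R (iexp (t * g x) *
      measure_pmf.expectation (replicate_pmf n p) (\<lambda>xs. iexp (t * sum_list (map g xs)))))"
    by (simp add: distrib_left exp_add)
  also have "\<dots> = (\<Sum>x\<in>set_pmf p. pmf p x *\<^sub>R iexp (t * g x)) *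
      measure_pmf.expectation (replicate_pmf n p) (\<lambda>xs. iexp (t * sum_list (map g xs)))"
    by (simp add: sum_distrib_right)
  also have "(\<Sum>x\<in>set_pmf p. pmf p x *\<^sub>R iexp (t * g x)) = char (distr (measure_pmf p) borel g) t"
    using assms by (simp add: char_def integral_distr integral_measure_pmf)
  also have "measure_pmf.expectation (replicate_pmf n p) (\<lambda>xs. iexp (t * sum_list (map g xs))) =
     char (distr (measure_pmf p) borel g) t ^ n"
    using Suc by (simp add: char_def integral_distr)
  finally show ?case by simp
qed

text \<open>The central limit theorem speaks of one infinite independent sequence, while
  \<open>replicate_pmf n p\<close> is another space for each \<open>n\<close>. It is applied to the
  coordinates of the infinite product of \<open>p\<close>; the laws of the sums over
  \<open>n\<close> letters agree because their characteristic functions do.\<close>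

lemma replicate_pmf_central_limit:
  fixes p :: "'a pmf" and g :: "'a \<Rightarrow> real"
  assumes fin: "finite (set_pmf p)"
    and v: "measure_pmf.variance p g > 0"
  shows "weak_conv_m
    (\<lambda>n. distr (measure_pmf (replicate_pmf n p)) borel
       (\<lambda>xs. (sum_list (map g xs) - n * measure_pmf.expectation p g) / sqrt (n * measure_pmf.variance p g)))
    std_normal_distribution"
proof -
  define v where "v = measure_pmf.variance p g"
  define m where "m = measure_pmf.expectation p g"
  define M where "M = PiM UNIV (\<lambda>_::nat. measure_pmf p)"
  interpret PP: product_prob_space "\<lambda>_::nat. measure_pmf p" UNIV
    by unfold_locales
  interpret M: prob_space M unfolding M_def by (rule PP.prob_space_axioms)
  have coord: "distr M (measure_pmf p) (\<lambda>\<omega>. \<omega> i) = measure_pmf p" for i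
    unfolding M_def by (rule PP.PiM_component) auto
  have meas [measurable]: "(\<lambda>\<omega>. \<omega> i) \<in> M \<rightarrow>\<^sub>M measure_pmf p" for i
    unfolding M_def by (rule measurable_component_singleton) simp
  have measg [measurable]: "g \<in> measure_pmf p \<rightarrow>\<^sub>M borel" by simp
  \<comment> \<open>The family of all coordinates is the identity map on \<open>M\<close>, so its
    joint law is \<open>M\<close> itself, the product of the marginals.\<close>
  have ind0: "M.indep_vars (\<lambda>_. measure_pmf p) (\<lambda>i \<omega>. \<omega> i) UNIV"
  proof (subst M.indep_vars_iff_distr_eq_PiM')
    have "distr M (PiM UNIV (\<lambda>_. measure_pmf p)) (\<lambda>\<omega>. \<lambda>i\<in>UNIV. \<omega> i) = M"
      unfolding restrict_UNIV M_def by (rule distr_id2) simp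
    then show "distr M (PiM UNIV (\<lambda>_. measure_pmf p)) (\<lambda>\<omega>. \<lambda>i\<in>UNIV. \<omega> i) =
      PiM UNIV (\<lambda>i. distr M (measure_pmf p) (\<lambda>\<omega>. \<omega> i))"
      unfolding coord unfolding M_def .
    show "M.random_variable (measure_pmf p) (\<lambda>\<omega>. \<omega> i)" for i
      by (rule meas)
  qed simp
  have ind: "M.indep_vars (\<lambda>_. borel) (\<lambda>i \<omega>. g (\<omega> i)) UNIV"
    using M.indep_vars_compose2[OF ind0, of "\<lambda>_. g" "\<lambda>_. borel"] by simp
  have dist: "distr M borel (\<lambda>\<omega>. g (\<omega> i)) = distr (measure_pmf p) borel g" for i
    using distr_distr[OF measg meas, of i] by (simp add: coord comp_def)
  have int: "M.expectation (\<lambda>\<omega>. h (\<omega> i)) = measure_pmf.expectation p h" for h :: "'a \<Rightarrow> real" and i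
    using integral_distr[OF meas, of h i] by (simp add: coord)
  have "integrable (distr M (measure_pmf p) (\<lambda>\<omega>. \<omega> i)) (\<lambda>x. (g x)\<^sup>2)" for i
    unfolding coord using fin by (rule integrable_measure_pmf_finite)
  then have sq: "integrable M (\<lambda>\<omega>. (g (\<omega> i))\<^sup>2)" for i
    by (subst (asm) integrable_distr_eq[OF meas]) simp_all
  have sv: "(sqrt v)\<^sup>2 = v" using v by (simp add: v_def)
  have clt: "weak_conv_m (\<lambda>n. distr M borel (\<lambda>\<omega>. (\<Sum>i<n. g (\<omega> i) - m) / sqrt (n * (sqrt v)\<^sup>2)))
     std_normal_distribution"
    by (rule M.central_limit_theorem[OF ind _ _ sq _ dist])
       (use v in \<open>auto simp: v_def m_def int[of g] int[of "\<lambda>x. (g x - m)\<^sup>2", unfolded m_def]\<close>)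
  have "distr M borel (\<lambda>\<omega>. \<Sum>i<n. g (\<omega> i)) =
      distr (measure_pmf (replicate_pmf n p)) borel (\<lambda>xs. sum_list (map g xs))" for n
  proof (rule Levy_uniqueness)
    show "real_distribution (distr M borel (\<lambda>\<omega>. \<Sum>i<n. g (\<omega> i)))"
      by (rule M.real_distribution_distr) simp
    show "real_distribution (distr (measure_pmf (replicate_pmf n p)) borel (\<lambda>xs. sum_list (map g xs)))"
      by (rule prob_space.real_distribution_distr[OF prob_space_measure_pmf]) simp
    have "char (distr M borel (\<lambda>\<omega>. \<Sum>i<n. g (\<omega> i))) t =
       char (distr (measure_pmf p) borel g) t ^ n" for t
      by (subst M.char_distr_sum[OF M.indep_vars_subset[OF ind]]) (auto simp: dist)
    then show "char (distr M borel (\<lambda>\<omega>. \<Sum>i<n. g (\<omega> i))) =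
      char (distr (measure_pmf (replicate_pmf n p)) borel (\<lambda>xs. sum_list (map g xs)))"
      by (simp add: char_distr_replicate_pmf[OF fin] fun_eq_iff)
  qed
  then have "distr (distr M borel (\<lambda>\<omega>. \<Sum>i<n. g (\<omega> i))) borel (\<lambda>x. (x - n * m) / sqrt (n * v)) =
      distr (distr (measure_pmf (replicate_pmf n p)) borel (\<lambda>xs. sum_list (map g xs)))
        borel (\<lambda>x. (x - n * m) / sqrt (n * v))" for n
    by simp
  then have "distr M borel (\<lambda>\<omega>. (\<Sum>i<n. g (\<omega> i) - m) / sqrt (n * (sqrt v)\<^sup>2)) =
      distr (measure_pmf (replicate_pmf n p)) borel
       (\<lambda>xs. (sum_list (map g xs) - n * m) / sqrt (n * v))" for n
    by (simp add: distr_distr comp_def sum_subtractf sv)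
  then show ?thesis
    using clt unfolding v_def m_def by simp
qed

text \<open>Weak convergence gives convergence of distribution functions only at continuity points
  of the limit. The normal law has a density, so points have no mass and every \<open>x\<close>
  qualifies.\<close>

lemma isCont_Phi: "isCont Phi x"
proof -
  interpret N: real_distribution std_normal_distribution by (rule real_dist_normal_dist)
  have "emeasure std_normal_distribution {x} = 0"
    by (subst emeasure_density) (auto simp: nn_integral_cmult_indicator)
  then show ?thesis
    unfolding Phi_def N.isCont_cdf by (simp add: measure_def)
qed

text \<open>The normal characteristic function is even, so the law is symmetric. Since
  \<open>{x}\<close> is null, including or excluding the endpoint makes no difference.\<close>

lemma Phi_minus: "Phi (- x) = 1 - Phi x"
proof -
  interpret N: real_distribution std_normal_distribution by (rule real_dist_normal_dist)
  have sym: "distr std_normal_distribution borel uminus = std_normal_distribution"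
  proof (rule Levy_uniqueness)
    show "real_distribution (distr std_normal_distribution borel uminus)"
      by (rule N.real_distribution_distr) simp
    have "char (distr std_normal_distribution borel uminus) t = char std_normal_distribution (- t)" for t
      by (simp add: char_def integral_distr)
    then show "char (distr std_normal_distribution borel uminus) = char std_normal_distribution"
      by (simp add: char_std_normal_distribution fun_eq_iff)
  qed (rule real_dist_normal_dist)
  have null: "measure std_normal_distribution {x} = 0"
    using isCont_Phi[of x] unfolding Phi_def N.isCont_cdf .
  have "Phi (- x) = measure (distr std_normal_distribution borel uminus) {..- x}"
    by (simp add: sym Phi_def cdf_def)
  also have "\<dots> = measure std_normal_distribution {x..}"
    by (subst measure_distr) (auto intro!: arg_cong[where f="measure _"])
  also have "{x..} = UNIV - {..<x}" by auto
  also have "measure std_normal_distribution \<dots> = 1 - measure std_normal_distribution {..<x}"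
    using N.prob_compl[of "{..<x}"] by simp
  also have "measure std_normal_distribution {..x} = measure std_normal_distribution ({..<x} \<union> {x})"
    by (rule arg_cong[where f="measure _"]) auto
  then have "measure std_normal_distribution {..<x} = Phi x"
    by (subst (asm) N.finite_measure_Union) (auto simp: null Phi_def cdf_def)
  finally show ?thesis .
qed

text \<open>Monotonicity traps \<open>F n (x n)\<close> between the values of \<open>F n\<close> at
  two fixed points close to \<open>a\<close>. This is what absorbs rounding and logarithmic shifts
  of the thresholds.\<close>

lemma tendsto_moving_point:
  fixes F :: "nat \<Rightarrow> real \<Rightarrow> real"
  assumes mono: "\<And>n. mono (F n)"
    and lim: "\<And>x. (\<lambda>n. F n x) \<longlonglongrightarrow> G x"
    and cont: "isCont G a"
    and x: "x \<longlonglongrightarrow> a"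
  shows "(\<lambda>n. F n (x n)) \<longlonglongrightarrow> G a"
proof (rule tendstoI)
  fix e :: real assume "e > 0"
  then obtain d where d: "d > 0" "\<And>y. dist y a < d \<Longrightarrow> dist (G y) (G a) < e / 2"
    using cont unfolding continuous_at_eps_delta by (metis half_gt_zero)
  have b: "dist (G (a - d/2)) (G a) < e / 2" "dist (G (a + d/2)) (G a) < e / 2"
    using d(1) by (auto intro!: d(2)[unfolded dist_real_def] simp del: less_divide_eq_numeral1 simp: dist_real_def)
  have "eventually (\<lambda>n. dist (F n (a - d/2)) (G (a - d/2)) < e/2) sequentially"
    "eventually (\<lambda>n. dist (F n (a + d/2)) (G (a + d/2)) < e/2) sequentially"
    "eventually (\<lambda>n. dist (x n) a < d/2) sequentially"
    by (intro tendstoD[OF lim] tendstoD[OF x]; use \<open>e > 0\<close> d(1) in simp)+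
  then show "eventually (\<lambda>n. dist (F n (x n)) (G a) < e) sequentially"
  proof eventually_elim
    case (elim n)
    have "F n (a - d/2) \<le> F n (x n)" "F n (x n) \<le> F n (a + d/2)"
      using elim(3) unfolding dist_real_def by (intro monoD[OF mono]; linarith)+
    then show ?case using elim b unfolding dist_real_def by linarith
  qed
qed

section \<open>Majorization and fidelity\<close>

text \<open>\<open>decr\<close> sorts values and forgets which elements carry them. Ordering the
  elements themselves makes each partial sum the probability of a concrete set.\<close>

lemma decr_enumeration:
  assumes "finite X"
  obtains xs where "distinct xs" "set xs = X"
    "\<And>i j. i \<le> j \<Longrightarrow> j < length xs \<Longrightarrow> pmf P (xs ! j) \<le> pmf P (xs ! i)"
    "\<And>k. (\<Sum>i=1..k. decr X P i) = measure_pmf.prob P (set (take k xs))"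
proof -
  obtain ys where ys: "set ys = X" "distinct ys"
    using finite_distinct_list[OF assms] by blast
  define xs where "xs = rev (sort_key (pmf P) ys)"
  have xs: "set xs = X" "distinct xs" and len: "length xs = card X"
    using ys by (auto simp: xs_def distinct_card)
  have mset: "mset_set X = mset ys"
    using ys mset_set_set by metis
  have map: "rev (sorted_list_of_multiset (image_mset (pmf P) (mset_set X))) = map (pmf P) xs"
  proof -
    \<comment> \<open>However \<open>sort_key\<close> orders ties, its list of keys is sorted and
      has the right multiset.\<close>
    have "sort (map (pmf P) ys) = map (pmf P) (sort_key (pmf P) ys)"
      by (rule properties_for_sort) (simp_all del: sort_key_simps)
    then show ?thesis
      by (simp only: mset xs_def rev_map sorted_list_of_multiset_mset flip: mset_map)
  qed
  have sorted: "sorted (rev (map (pmf P) xs))"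
    by (simp add: xs_def rev_map)
  have "(\<Sum>i=1..k. decr X P i) = measure_pmf.prob P (set (take k xs))" for k
  proof -
    have "(\<Sum>i=1..k. decr X P i) = (\<Sum>i<k. decr X P (Suc i))"
      by (rule sum.reindex_bij_witness[of _ Suc "\<lambda>i. i - 1"]) auto
    also have "\<dots> = (\<Sum>i<k. if i < card X then pmf P (xs ! i) else 0)"
      by (intro sum.cong) (auto simp: decr_def map len)
    also have "\<dots> = (\<Sum>i<min k (card X). pmf P (xs ! i))"
      by (subst sum.inter_filter[symmetric]) (auto intro!: sum.cong)
    also have "\<dots> = sum_list (map (pmf P) (take k xs))"
      by (auto simp: sum_list_sum_nth len min.commute atLeast0LessThan intro!: sum.cong)
    also have "\<dots> = (\<Sum>x\<in>set (take k xs). pmf P x)"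
      using xs(2) by (simp add: sum_list_distinct_conv_sum_set)
    finally show ?thesis by (simp add: measure_measure_pmf_finite)
  qed
  moreover have "pmf P (xs ! j) \<le> pmf P (xs ! i)" if "i \<le> j" "j < length xs" for i j
    using sorted_rev_nth_mono[OF sorted, of i j] that by simp
  ultimately show ?thesis using that xs by blast
qed

text \<open>Together with \<open>prob_le_sum_decr\<close> this says that the sum of the
  \<open>k\<close> largest values is the maximal probability of a set of at most \<open>k\<close>
  elements. Later majorization arguments use partial sums in this form.\<close>

lemma sum_decr_eq_prob:
  assumes "finite X"
  obtains A where "A \<subseteq> X" "card A \<le> k" "(\<Sum>i=1..k. decr X P i) = measure_pmf.prob P A"
proof -
  obtain xs where "distinct xs" "set xs = X"
    and "\<And>k. (\<Sum>i=1..k. decr X P i) = measure_pmf.prob P (set (take k xs))"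
    using decr_enumeration[OF assms] by metis
  then show ?thesis
    using that[of "set (take k xs)"] set_take_subset[of k xs] by (simp add: distinct_card)
qed

text \<open>Exchange argument: with \<open>T\<close> the first \<open>k\<close> elements and
  \<open>c\<close> the first weight left out, \<open>A - T\<close> has no more elements than
  \<open>T - A\<close>, and its weights are at most \<open>c\<close> while those of
  \<open>T - A\<close> are at least \<open>c\<close>.\<close>

lemma prob_le_sum_decr:
  assumes "finite X" "A \<subseteq> X" "card A \<le> k"
  shows "measure_pmf.prob P A \<le> (\<Sum>i=1..k. decr X P i)"
proof -
  obtain xs where xs: "distinct xs" "set xs = X"
    and mono: "\<And>i j. i \<le> j \<Longrightarrow> j < length xs \<Longrightarrow> pmf P (xs ! j) \<le> pmf P (xs ! i)"
    and top: "\<And>k. (\<Sum>i=1..k. decr X P i) = measure_pmf.prob P (set (take k xs))"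
    using decr_enumeration[OF assms(1)] by metis
  define T where "T = set (take k xs)"
  have fin: "finite A" "finite T"
    using assms finite_subset by (auto simp: T_def)
  have "measure_pmf.prob P A \<le> measure_pmf.prob P T"
  proof (cases "length xs \<le> k")
    case True
    then show ?thesis using assms xs by (auto simp: T_def intro: measure_pmf.finite_measure_mono)
  next
    case False
    define c where "c = pmf P (xs ! k)"
    have "card T = k" using False xs by (simp add: T_def distinct_card)
    then have "card (A - T) \<le> card (T - A)"
      using assms(3) fin by (simp add: card_Diff_subset_Int Int_commute)
    have T: "c \<le> pmf P x" if "x \<in> T" for x
      using that False mono[of _ k] by (auto simp: T_def c_def in_set_conv_nth)
    have A: "pmf P x \<le> c" if "x \<in> A - T" for x
    proof -
      have "x \<in> set xs" using that assms xs by auto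
      then obtain i where i: "i < length xs" "x = xs ! i" by (auto simp: in_set_conv_nth)
      have "k \<le> i"
      proof (rule ccontr)
        assume "\<not> k \<le> i"
        then have "x \<in> T" using i by (auto simp: T_def in_set_conv_nth intro!: exI[of _ i])
        then show False using that by auto
      qed
      then show ?thesis using mono i by (auto simp: c_def)
    qed
    have "(\<Sum>x\<in>A - T. pmf P x) \<le> card (A - T) * c"
      using A by (rule sum_bounded_above)
    also have "\<dots> \<le> card (T - A) * c"
      using \<open>card (A - T) \<le> card (T - A)\<close> by (intro mult_right_mono) (auto simp: c_def)
    also have "\<dots> \<le> (\<Sum>x\<in>T - A. pmf P x)"
      using T by (intro sum_bounded_below) auto
    finally have "(\<Sum>x\<in>A - T. pmf P x) + (\<Sum>x\<in>A \<inter> T. pmf P x)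
        \<le> (\<Sum>x\<in>T - A. pmf P x) + (\<Sum>x\<in>T \<inter> A. pmf P x)"
      by (simp add: Int_commute)
    then show ?thesis
      using fin by (simp add: measure_measure_pmf_finite sum.Int_Diff[of A _ T] sum.Int_Diff[of T _ A] add.commute)
  qed
  then show ?thesis unfolding top T_def .
qed

text \<open>The image of a set of at most \<open>k\<close> elements has at most \<open>k\<close>
  elements and carries at least the same mass.\<close>

lemma majorized_map_pmf:
  assumes "finite X" "finite Z" "f \<in> X \<rightarrow> Z"
  shows "majorized X P Z (map_pmf f P)"
  unfolding majorized_def
proof
  fix k
  obtain A where A: "A \<subseteq> X" "card A \<le> k" "(\<Sum>i=1..k. decr X P i) = measure_pmf.prob P A"
    using sum_decr_eq_prob[OF assms(1)] by blast
  have "finite A" using A assms finite_subset by blast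
  have "measure_pmf.prob P A \<le> measure_pmf.prob P (f -` f ` A)"
    by (rule measure_pmf.finite_measure_mono) auto
  also have "\<dots> = measure_pmf.prob (map_pmf f P) (f ` A)"
    by simp
  also have "\<dots> \<le> (\<Sum>i=1..k. decr Z (map_pmf f P) i)"
    using A assms card_image_le[OF \<open>finite A\<close>, of f] by (intro prob_le_sum_decr) auto
  finally show "(\<Sum>i=1..k. decr X P i) \<le> (\<Sum>i=1..k. decr Z (map_pmf f P) i)"
    using A by simp
qed

section \<open>Cauchy-Schwarz bounds on the fidelity\<close>

lemma sum_sqrt_pmf_le:
  assumes "finite B"
  shows "(\<Sum>y\<in>B. sqrt (pmf Q y) * sqrt (pmf R y))
    \<le> sqrt (measure_pmf.prob Q B * measure_pmf.prob R B)"
proof (rule real_le_rsqrt)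
  show "(\<Sum>y\<in>B. sqrt (pmf Q y) * sqrt (pmf R y))\<^sup>2
      \<le> measure_pmf.prob Q B * measure_pmf.prob R B"
    using Cauchy_Schwarz_ineq_sum[of "\<lambda>y. sqrt (pmf Q y)" "\<lambda>y. sqrt (pmf R y)" B]
    by (simp add: measure_measure_pmf_finite[OF assms])
qed

lemma fidelity_le_1:
  assumes "finite Y"
  shows "fidelity Y Q R \<le> 1"
proof -
  have "measure_pmf.prob Q Y * measure_pmf.prob R Y \<le> 1"
    by (simp add: mult_le_one)
  then show ?thesis
    using sum_sqrt_pmf_le[OF assms, of Q R] unfolding fidelity_def
    by (meson order_trans real_sqrt_le_1_iff)
qed

text \<open>Cauchy-Schwarz is applied on \<open>A\<close> and on its complement separately. With
  \<open>R\<close> uniform and \<open>A\<close> small, the first term is negligible, so the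
  \<open>Q\<close>-mass on \<open>A\<close> is lost for the fidelity.\<close>

lemma fidelity_le_split:
  assumes "finite Y" "A \<subseteq> Y"
  shows "fidelity Y Q R \<le> sqrt (measure_pmf.prob R A) + sqrt (1 - measure_pmf.prob Q A)"
proof -
  have fin: "finite A" "finite (Y - A)" using assms finite_subset by auto
  have "fidelity Y Q R = (\<Sum>y\<in>A. sqrt (pmf Q y) * sqrt (pmf R y))
      + (\<Sum>y\<in>Y - A. sqrt (pmf Q y) * sqrt (pmf R y))"
    unfolding fidelity_def using assms by (simp add: sum.subset_diff add.commute)
  also have "\<dots> \<le> sqrt (measure_pmf.prob Q A * measure_pmf.prob R A)
      + sqrt (measure_pmf.prob Q (Y - A) * measure_pmf.prob R (Y - A))"
    using fin by (intro add_mono sum_sqrt_pmf_le)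
  also have "\<dots> \<le> sqrt (measure_pmf.prob R A) + sqrt (1 - measure_pmf.prob Q A)"
  proof -
    have "measure_pmf.prob Q (Y - A) \<le> measure_pmf.prob Q (UNIV - A)"
      by (rule measure_pmf.finite_measure_mono) auto
    also have "\<dots> = 1 - measure_pmf.prob Q A"
      using measure_pmf.prob_compl[of A Q] by simp
    finally have "measure_pmf.prob Q (Y - A) * measure_pmf.prob R (Y - A) \<le> 1 - measure_pmf.prob Q A"
      using mult_mono[of "measure_pmf.prob Q (Y - A)" "1 - measure_pmf.prob Q A"
          "measure_pmf.prob R (Y - A)" 1] by simp
    moreover have "measure_pmf.prob Q A * measure_pmf.prob R A \<le> measure_pmf.prob R A"
      by (simp add: mult_left_le_one_le)
    ultimately show ?thesis by (simp add: add_mono)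
  qed
  finally show ?thesis .
qed

section \<open>Comparison of the two fidelities, and upper bounds for the majorization
  fidelity\<close>

lemma finite_storage: "finite (storage N)"
  by (simp add: storage_def)

lemma bdd_above_fidelity:
  assumes "finite Y"
  shows "bdd_above ((\<lambda>i. fidelity Y (q i) Q) ` I)"
  using fidelity_le_1[OF assms] by (intro bdd_aboveI[of _ 1]) auto

text \<open>Serves twice: to compare the two suprema, and to show that the supremum in
  \<open>fidelity_maj\<close> runs over a nonempty set.\<close>

lemma maj_feasible:
  assumes "finite X" "P \<in> dists X" "finite Y"
    and "f \<in> X \<rightarrow> storage N" "f' \<in> storage N \<rightarrow> Y"
  shows "map_pmf f' (map_pmf f P) \<in> {P'' \<in> dists Y. \<exists>P' \<in> dists (storage N).
     majorized X P (storage N) P' \<and> majorized (storage N) P' Y P''}"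
proof -
  have "map_pmf f P \<in> dists (storage N)" "map_pmf f' (map_pmf f P) \<in> dists Y"
    using assms by (auto simp: dists_def Pi_iff subset_iff)
  then show ?thesis
    using majorized_map_pmf[OF assms(1) finite_storage assms(4), of P]
      majorized_map_pmf[OF finite_storage assms(3) assms(5), of "map_pmf f P"] by blast
qed

lemma fidelity_det_le_maj:
  assumes "finite X" "P \<in> dists X" "finite Y" "Y \<noteq> {}" "storage N \<noteq> {}"
  shows "fidelity_det X P Y Q N \<le> fidelity_maj X P Y Q N"
  unfolding fidelity_det_def
proof (rule cSUP_least)
  show "(X \<rightarrow> storage N) \<times> (storage N \<rightarrow> Y) \<noteq> {}"
    using assms by (simp add: Pi_eq_empty)
next
  fix ff assume "ff \<in> (X \<rightarrow> storage N) \<times> (storage N \<rightarrow> Y)"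
  then obtain f f' where ff: "ff = (f, f')" "f \<in> X \<rightarrow> storage N" "f' \<in> storage N \<rightarrow> Y" by auto
  show "(case ff of (f, f') \<Rightarrow> fidelity Y (map_pmf f' (map_pmf f P)) Q) \<le> fidelity_maj X P Y Q N"
    unfolding fidelity_maj_def ff prod.case
    by (rule cSUP_upper[OF maj_feasible bdd_above_fidelity]) (use assms ff in auto)
qed

text \<open>Common form of both upper bounds: majorization forces mass \<open>p\<close> onto
  \<open>k\<close> target points, which hold at most a fraction \<open>k / card Y\<close> of the
  uniform distribution. It is used with \<open>k\<close> the storage size and \<open>p = 1\<close>,
  and with \<open>k = card B\<close> and \<open>p\<close> the probability of
  \<open>B\<close>.\<close>

lemma fidelity_maj_le:
  assumes "finite X" "P \<in> dists X" "finite Y" "Y \<noteq> {}" "storage N \<noteq> {}"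
    and bound: "\<And>P' P''. P' \<in> dists (storage N) \<Longrightarrow> majorized X P (storage N) P' \<Longrightarrow>
      majorized (storage N) P' Y P'' \<Longrightarrow> p \<le> (\<Sum>i=1..k. decr Y P'' i)"
  shows "fidelity_maj X P Y (pmf_of_set Y) N \<le> sqrt (real k / real (card Y)) + sqrt (1 - p)"
  unfolding fidelity_maj_def
proof (rule cSUP_least)
  obtain f f' where "f \<in> X \<rightarrow> storage N" "f' \<in> storage N \<rightarrow> Y"
    using assms by (meson Pi_I all_not_in_conv)
  then show "{P'' \<in> dists Y. \<exists>P' \<in> dists (storage N).
     majorized X P (storage N) P' \<and> majorized (storage N) P' Y P''} \<noteq> {}"
    using maj_feasible[OF assms(1-3)] by blast
next
  fix P'' assume P'': "P'' \<in> {P'' \<in> dists Y. \<exists>P' \<in> dists (storage N).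
     majorized X P (storage N) P' \<and> majorized (storage N) P' Y P''}"
  obtain A where A: "A \<subseteq> Y" "card A \<le> k" "(\<Sum>i=1..k. decr Y P'' i) = measure_pmf.prob P'' A"
    using sum_decr_eq_prob[OF assms(3)] by blast
  have "p \<le> measure_pmf.prob P'' A"
    using P'' bound unfolding A(3)[symmetric] by blast
  moreover have "measure_pmf.prob (pmf_of_set Y) A \<le> real k / real (card Y)"
    using assms A by (auto simp: measure_pmf_of_set Int_absorb1 divide_right_mono)
  ultimately show "fidelity Y P'' (pmf_of_set Y) \<le> sqrt (real k / real (card Y)) + sqrt (1 - p)"
    by (intro order_trans[OF fidelity_le_split[OF assms(3) A(1)]] add_mono real_sqrt_le_mono) auto
qed

text \<open>The storage distribution has all its mass on \<open>card (storage N)\<close> points, and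
  majorization passes this concentration on to the target.\<close>

lemma fidelity_maj_le_storage:
  assumes "finite X" "P \<in> dists X" "finite Y" "Y \<noteq> {}" "storage N \<noteq> {}"
  shows "fidelity_maj X P Y (pmf_of_set Y) N \<le> sqrt (real (card (storage N)) / real (card Y))"
proof -
  have "1 \<le> (\<Sum>i=1..card (storage N). decr Y P'' i)"
    if "P' \<in> dists (storage N)" "majorized (storage N) P' Y P''" for P' P''
  proof -
    have "1 = measure_pmf.prob P' (storage N)"
      using that by (simp add: dists_def measure_pmf.prob_eq_1 AE_measure_pmf_iff subset_iff)
    also have "\<dots> \<le> (\<Sum>i=1..card (storage N). decr (storage N) P' i)"
      by (rule prob_le_sum_decr[OF finite_storage]) auto
    also have "\<dots> \<le> (\<Sum>i=1..card (storage N). decr Y P'' i)"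
      using that by (simp add: majorized_def)
    finally show ?thesis .
  qed
  then have "fidelity_maj X P Y (pmf_of_set Y) N
      \<le> sqrt (real (card (storage N)) / real (card Y)) + sqrt (1 - 1)"
    by (intro fidelity_maj_le[OF assms]) auto
  then show ?thesis by simp
qed

text \<open>The partial-sum inequalities compose, so the intermediate distribution drops out and the
  target is at least as concentrated as \<open>P\<close> is on \<open>B\<close>.\<close>

lemma fidelity_maj_le_prob:
  assumes "finite X" "P \<in> dists X" "finite Y" "Y \<noteq> {}" "storage N \<noteq> {}"
    and "B \<subseteq> X"
  shows "fidelity_maj X P Y (pmf_of_set Y) N
    \<le> sqrt (real (card B) / real (card Y)) + sqrt (1 - measure_pmf.prob P B)"
proof (rule fidelity_maj_le[OF assms(1-5)])
  fix P' P'' assume "majorized X P (storage N) P'" "majorized (storage N) P' Y P''"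
  then have "(\<Sum>i=1..card B. decr X P i) \<le> (\<Sum>i=1..card B. decr Y P'' i)"
    unfolding majorized_def using order_trans by blast
  then show "measure_pmf.prob P B \<le> (\<Sum>i=1..card B. decr Y P'' i)"
    using prob_le_sum_decr[OF assms(1) assms(6) order_refl, of P] by linarith
qed

section \<open>Greedy binning and the lower bound for the deterministic fidelity\<close>

lemma greedy_subset:
  fixes w :: "'a \<Rightarrow> real" and a e :: real
  assumes "finite C" "\<And>x. x \<in> C \<Longrightarrow> w x \<le> e" "0 \<le> a" "0 \<le> e" "a \<le> sum w C"
  shows "\<exists>B\<subseteq>C. a \<le> sum w B \<and> sum w B \<le> a + e"
  using assms
proof (induction C)
  case empty
  then show ?case by auto
next
  case (insert x C)
  show ?case
  proof (cases "a \<le> sum w C")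
    case True
    then show ?thesis using insert by (meson insertCI subset_insertI2)
  next
    case False
    \<comment> \<open>Without \<open>x\<close> the sum stays below \<open>a\<close>, so adding this
      one weight overshoots \<open>a\<close> by at most \<open>e\<close>.\<close>
    have "w x \<le> e" using insert by auto
    then have "sum w (insert x C) \<le> a + e" using False insert.hyps by simp
    then show ?thesis using insert.prems by blast
  qed
qed

text \<open>Bins are filled one at a time. Each takes a subset of weight between \<open>a\<close>
  and \<open>a + e\<close>, so a budget of \<open>a + e\<close> per bin suffices for all of them.
  Leftover points may be sent anywhere, even outside \<open>Y\<close>.\<close>

lemma greedy_binning:
  fixes w :: "'a \<Rightarrow> real" and a e :: real
  assumes "finite Y" "finite C" "\<And>x. x \<in> C \<Longrightarrow> w x \<le> e" "\<And>x. x \<in> C \<Longrightarrow> 0 \<le> w x"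
    and "0 \<le> a" "0 \<le> e" "card Y * (a + e) \<le> sum w C"
  shows "\<exists>g. \<forall>y\<in>Y. a \<le> sum w {x \<in> C. g x = y}"
  using assms
proof (induction Y arbitrary: C)
  case empty
  then show ?case by auto
next
  case (insert y Y)
  have total: "card Y * (a + e) + (a + e) \<le> sum w C"
    using insert by (simp add: algebra_simps)
  moreover have "0 \<le> card Y * (a + e)" using insert by simp
  ultimately have "a \<le> sum w C" using insert by linarith
  then obtain B where B: "B \<subseteq> C" "a \<le> sum w B" "sum w B \<le> a + e"
    using greedy_subset[of C w e a] insert.prems by blast
  have "card Y * (a + e) \<le> sum w (C - B)"
    using total B insert.prems by (simp add: sum_diff finite_subset)
  then have "\<exists>g. \<forall>y\<in>Y. a \<le> sum w {x \<in> C - B. g x = y}"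
    using insert.prems by (intro insert.IH) auto
  then obtain g where g: "\<forall>y\<in>Y. a \<le> sum w {x \<in> C - B. g x = y}" by blast
  define g' where "g' x = (if x \<in> B then y else g x)" for x
  have "a \<le> sum w {x \<in> C. g' x = z}" if "z \<in> insert y Y" for z
  proof (cases "z = y")
    case True
    \<comment> \<open>Only an inequality, since \<open>g\<close> may already send points outside
      \<open>B\<close> to \<open>y\<close>.\<close>
    have "sum w B \<le> sum w {x \<in> C. g' x = z}"
      using insert.prems B True by (intro sum_mono2) (auto simp: g'_def)
    then show ?thesis using B by simp
  next
    case False
    then have "{x \<in> C. g' x = z} = {x \<in> C - B. g x = z}" by (auto simp: g'_def)
    then show ?thesis using g that False by auto
  qed
  then show ?case by blast
qed

text \<open>A storage at least as large as the target is no constraint: an injection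
  \<open>h\<close> stores \<open>g x\<close> and \<open>f'\<close> decodes it. States outside the
  image of \<open>h\<close> are decoded to \<open>y0\<close> merely to keep \<open>f'\<close> inside
  \<open>Y\<close>.\<close>

lemma fidelity_det_ge_map:
  assumes "P \<in> dists X" "finite Y" "Y \<noteq> {}" "card Y \<le> card (storage N)" "g \<in> X \<rightarrow> Y"
  shows "fidelity Y (map_pmf g P) Q \<le> fidelity_det X P Y Q N"
proof -
  obtain h where h: "h ` Y \<subseteq> storage N" "inj_on h Y"
    using card_le_inj[OF assms(2) finite_storage assms(4)] by auto
  obtain y0 where y0: "y0 \<in> Y" using assms by auto
  define f' where "f' i = (if i \<in> h ` Y then inv_into Y h i else y0)" for i
  have "map_pmf f' (map_pmf (h \<circ> g) P) = map_pmf g P"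
    unfolding map_pmf_comp
    using assms h by (intro map_pmf_cong) (auto simp: f'_def dists_def Pi_iff subset_iff)
  moreover have "(h \<circ> g, f') \<in> (X \<rightarrow> storage N) \<times> (storage N \<rightarrow> Y)"
    using assms h y0 by (auto simp: f'_def Pi_iff image_subset_iff)
  moreover have "bdd_above ((\<lambda>(f, f'). fidelity Y (map_pmf f' (map_pmf f P)) Q) `
      ((X \<rightarrow> storage N) \<times> (storage N \<rightarrow> Y)))"
    using bdd_above_fidelity[OF assms(2), of "\<lambda>(f, f'). map_pmf f' (map_pmf f P)" Q]
    by (simp add: case_prod_unfold)
  ultimately show ?thesis
    unfolding fidelity_det_def
    by (metis (mono_tags, lifting) cSUP_upper old.prod.case)
qed

text \<open>Each bin overshoots by at most \<open>e / card Y\<close>, hence all bins together by at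
  most \<open>e\<close>. So every target point can receive \<open>(prob C - e) / card Y\<close>, and
  summing the square roots against the uniform weights gives the bound.\<close>

lemma fidelity_det_ge_prob:
  assumes "finite X" "P \<in> dists X" "finite Y" "Y \<noteq> {}" "card Y \<le> card (storage N)"
    and "C \<subseteq> X" "0 \<le> e" "\<And>x. x \<in> C \<Longrightarrow> pmf P x \<le> e / card Y"
  shows "sqrt (measure_pmf.prob P C - e) \<le> fidelity_det X P Y (pmf_of_set Y) N"
proof -
  define M where "M = real (card Y)"
  have M: "M > 0" using assms by (simp add: M_def card_gt_0_iff)
  have finC: "finite C" using assms finite_subset by blast
  obtain y0 where y0: "y0 \<in> Y" using assms by auto
  \<comment> \<open>The truncation at 0 covers the case in which \<open>C\<close> has mass at most
    \<open>e\<close>: the claimed bound is then nonpositive and a constant map will do.\<close>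
  define a where "a = max 0 ((measure_pmf.prob P C - e) / M)"
  have "\<exists>g\<in>X \<rightarrow> Y. \<forall>y\<in>Y. a \<le> pmf (map_pmf g P) y"
  proof (cases "measure_pmf.prob P C \<le> e")
    case True
    then have "a = 0" using M by (simp add: a_def divide_nonpos_pos max_absorb1)
    then show ?thesis using y0 by (intro bexI[of _ "\<lambda>_. y0"]) auto
  next
    case False
    then have a: "a = (measure_pmf.prob P C - e) / M" using M by (simp add: a_def)
    have "real (card Y) * (a + e / M) = sum (pmf P) C"
      using M by (simp add: a measure_measure_pmf_finite[OF finC] field_simps flip: M_def)
    then obtain g where g: "\<forall>y\<in>Y. a \<le> sum (pmf P) {x \<in> C. g x = y}"
      using greedy_binning[of Y C "pmf P" "e / M" a] assms finC M by (auto simp: M_def a_def)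
    \<comment> \<open>Redirecting the points sent outside \<open>Y\<close> can only add mass to the
      bins.\<close>
    define g' where "g' x = (if g x \<in> Y then g x else y0)" for x
    have "a \<le> pmf (map_pmf g' P) y" if "y \<in> Y" for y
    proof -
      have "a \<le> measure_pmf.prob P {x \<in> C. g x = y}"
        using g that finC by (simp add: measure_measure_pmf_finite)
      also have "\<dots> \<le> measure_pmf.prob P (g' -` {y})"
        using that by (intro measure_pmf.finite_measure_mono) (auto simp: g'_def)
      finally show ?thesis by (simp add: pmf_map)
    qed
    moreover have "g' \<in> X \<rightarrow> Y" using y0 by (auto simp: g'_def)
    ultimately show ?thesis by blast
  qed
  then obtain g where g: "g \<in> X \<rightarrow> Y" "\<And>y. y \<in> Y \<Longrightarrow> a \<le> pmf (map_pmf g P) y" by blast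
  have "sqrt (measure_pmf.prob P C - e) \<le> sqrt (M * a)"
    using M by (simp add: a_def max_def field_simps)
  also have "\<dots> = M * (sqrt a * sqrt (1 / M))"
    using M by (simp add: real_sqrt_mult real_sqrt_divide field_simps)
  also have "\<dots> \<le> (\<Sum>y\<in>Y. sqrt (pmf (map_pmf g P) y) * sqrt (1 / M))"
    unfolding M_def by (rule sum_bounded_below) (use g in \<open>auto intro!: mult_right_mono\<close>)
  also have "\<dots> = fidelity Y (map_pmf g P) (pmf_of_set Y)"
    unfolding fidelity_def using assms by (simp add: M_def)
  also have "\<dots> \<le> fidelity_det X P Y (pmf_of_set Y) N"
    by (rule fidelity_det_ge_map) (use assms g in auto)
  finally show ?thesis .
qed

lemma card_mult_le_1_if_pmf_ge:
  assumes "finite B" "\<And>x. x \<in> B \<Longrightarrow> c \<le> pmf P x"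
  shows "real (card B) * c \<le> 1"
proof -
  have "real (card B) * c \<le> measure_pmf.prob P B"
    unfolding measure_measure_pmf_finite[OF assms(1)] using assms(2) by (rule sum_bounded_below)
  then show ?thesis using measure_pmf.prob_le_1[of P B] by linarith
qed

lemma fidelity_det_nonneg:
  assumes "finite Y" "Y \<noteq> {}" "storage N \<noteq> {}"
  shows "0 \<le> fidelity_det X P Y Q N"
proof -
  obtain k y where "k \<in> storage N" "y \<in> Y" using assms by blast
  then have ff: "((\<lambda>_. k), (\<lambda>_. y)) \<in> (X \<rightarrow> storage N) \<times> (storage N \<rightarrow> Y)" by auto
  have bdd: "bdd_above ((\<lambda>(f, f'). fidelity Y (map_pmf f' (map_pmf f P)) Q) `
      ((X \<rightarrow> storage N) \<times> (storage N \<rightarrow> Y)))"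
    using bdd_above_fidelity[OF assms(1), of "\<lambda>(f, f'). map_pmf f' (map_pmf f P)" Q]
    by (simp add: case_prod_unfold)
  show ?thesis
    unfolding fidelity_det_def
    by (rule cSUP_upper2[OF bdd ff]) (simp add: fidelity_def sum_nonneg)
qed

section \<open>Information content of words\<close>

lemma finite_words: "finite X \<Longrightarrow> finite (words X n)"
  and card_words: "finite X \<Longrightarrow> card (words X n) = card X ^ n"
  using finite_lists_length_eq[of X n] card_lists_length_eq[of X n]
  by (simp_all add: words_def conj_commute)

lemma replicate_pmf_in_dists: "P \<in> dists X \<Longrightarrow> replicate_pmf n P \<in> dists (words X n)"
  by (auto simp: dists_def words_def set_replicate_pmf)

lemma pmf_replicate_pmf:
  "length xs = n \<Longrightarrow> pmf (replicate_pmf n P) xs = prod_list (map (pmf P) xs)"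
proof (induction n arbitrary: xs)
  case 0
  then show ?case by simp
next
  case (Suc n)
  then obtain y ys where xs: "xs = y # ys" "length ys = n" by (auto simp: length_Suc_conv)
  \<comment> \<open>Prepending is injective, so the probability of \<open>y # ys\<close> is that of
    the pair, whose components are independent.\<close>
  have "replicate_pmf (Suc n) P = map_pmf (\<lambda>(x, xs). x # xs) (pair_pmf P (replicate_pmf n P))"
    by (simp add: pair_pmf_def map_bind_pmf)
  then have "pmf (replicate_pmf (Suc n) P) xs = pmf (pair_pmf P (replicate_pmf n P)) (y, ys)"
    using pmf_map_inj'[of "\<lambda>(x, xs). x # xs" "pair_pmf P (replicate_pmf n P)" "(y, ys)"]
    by (simp add: xs inj_def)
  then show ?case using Suc.IH xs by (simp add: pmf_pair)
qed

text \<open>Makes the i.i.d. target uniform again, so that the bounds for \<open>pmf_of_set\<close>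
  apply to it.\<close>

lemma replicate_pmf_of_set:
  assumes "finite Y" "Y \<noteq> {}"
  shows "replicate_pmf n (pmf_of_set Y) = pmf_of_set (words Y n)"
proof (rule pmf_eqI)
  fix xs
  have ne: "words Y n \<noteq> {}"
    using card_words[OF assms(1), of n] assms finite_words[OF assms(1)]
    by (metis card.empty card_0_eq power_not_zero)
  show "pmf (replicate_pmf n (pmf_of_set Y)) xs = pmf (pmf_of_set (words Y n)) xs"
  proof (cases "xs \<in> words Y n")
    case True
    then have "map (pmf (pmf_of_set Y)) xs = replicate n (1 / card Y)"
      using assms by (intro replicate_eqI) (auto simp: words_def)
    then show ?thesis
      using True assms ne finite_words[OF assms(1)]
      by (simp add: pmf_replicate_pmf words_def card_words[unfolded words_def] power_divide)
  next
    case False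
    then have "xs \<notin> set_pmf (replicate_pmf n (pmf_of_set Y))"
      using assms by (auto simp: set_replicate_pmf words_def)
    then show ?thesis
      using False ne finite_words[OF assms(1)] by (simp add: set_pmf_iff)
  qed
qed

section \<open>Entropy and varentropy as moments, and their positivity\<close>

lemma shannon_entropy_pmf_of_set:
  assumes "finite Y" "Y \<noteq> {}"
  shows "shannon_entropy Y (pmf_of_set Y) = log 2 (card Y)"
  using assms by (simp add: shannon_entropy_def log_divide)

lemma shannon_entropy_eq_expectation:
  assumes "finite X" "P \<in> dists X"
  shows "shannon_entropy X P = measure_pmf.expectation P (\<lambda>x. - log 2 (pmf P x))"
  using assms
  by (subst integral_measure_pmf[of X])
    (auto simp: shannon_entropy_def dists_def sum_negf)

lemma varentropy_eq_variance:
  assumes "finite X" "P \<in> dists X"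
  shows "varentropy X P = measure_pmf.variance P (\<lambda>x. - log 2 (pmf P x))"
  unfolding varentropy_def
  unfolding shannon_entropy_eq_expectation[OF assms, symmetric]
  using assms by (subst integral_measure_pmf[of X]) (auto simp: dists_def)

lemma uniform_if_pmf_constant:
  assumes "finite (set_pmf P)" "\<And>x. x \<in> set_pmf P \<Longrightarrow> pmf P x = c"
  shows "P = pmf_of_set (set_pmf P)"
proof (rule pmf_eqI)
  fix x
  have "1 = (\<Sum>x\<in>set_pmf P. pmf P x)"
    using assms(1) by (simp add: sum_pmf_eq_1)
  also have "\<dots> = real (card (set_pmf P)) * c"
    using assms(2) by simp
  finally have c: "c = 1 / card (set_pmf P)"
    by (metis mult_zero_left nonzero_eq_divide_eq mult.commute zero_neq_one)
  show "pmf P x = pmf (pmf_of_set (set_pmf P)) x"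
    using assms c by (cases "x \<in> set_pmf P") (auto simp: set_pmf_not_empty set_pmf_iff)
qed

text \<open>If the variance vanished, \<open>log 2 (pmf P x)\<close> would be constant on the
  support and \<open>P\<close> uniform there. Positivity keeps the central limit scaling
  nondegenerate.\<close>

lemma varentropy_pos:
  assumes "finite X" "P \<in> dists X" "non_uniform P"
  shows "varentropy X P > 0"
proof -
  define t where "t x = pmf P x * (- log 2 (pmf P x) - shannon_entropy X P)\<^sup>2" for x
  have sub: "set_pmf P \<subseteq> X" using assms by (simp add: dists_def)
  have "\<not> (\<forall>x\<in>X. t x = 0)"
  proof
    assume "\<forall>x\<in>X. t x = 0"
    then have "log 2 (pmf P x) = - shannon_entropy X P" if "x \<in> set_pmf P" for x
      using that sub by (fastforce simp: t_def set_pmf_iff)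
    then have "pmf P x = 2 powr - shannon_entropy X P" if "x \<in> set_pmf P" for x
      using that pmf_positive[OF that] powr_eq_iff[of "pmf P x" 2 "- shannon_entropy X P"] by simp
    then show False
      using uniform_if_pmf_constant[of P] assms finite_subset[OF sub]
      unfolding non_uniform_def by blast
  qed
  then obtain x where "x \<in> X" "t x \<noteq> 0" by blast
  moreover have "t x \<ge> 0" for x by (simp add: t_def)
  ultimately have "sum t X > 0"
    using assms(1) by (intro sum_pos2[of X x]) (auto simp: less_le)
  then show ?thesis by (simp add: varentropy_def t_def)
qed

text \<open>Zero entropy would force every support point to have probability 1, and a point mass is
  uniform on its support. Positivity makes the storage and target exponents grow.\<close>

lemma shannon_entropy_pos:
  assumes "finite X" "P \<in> dists X" "non_uniform P"
  shows "shannon_entropy X P > 0"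
proof -
  define t where "t x = - (pmf P x * log 2 (pmf P x))" for x
  have sub: "set_pmf P \<subseteq> X" using assms by (simp add: dists_def)
  have nonneg: "t x \<ge> 0" for x
    by (cases "pmf P x = 0") (auto simp: t_def mult_le_0_iff pmf_le_1 pmf_pos)
  have "\<not> (\<forall>x\<in>X. t x = 0)"
  proof
    assume "\<forall>x\<in>X. t x = 0"
    then have "log 2 (pmf P x) = 0" if "x \<in> set_pmf P" for x
      using that sub by (fastforce simp: t_def set_pmf_iff)
    then have "pmf P x = 1" if "x \<in> set_pmf P" for x
      using that pmf_positive[OF that] powr_eq_iff[of "pmf P x" 2 0] by simp
    then show False
      using uniform_if_pmf_constant[of P] assms finite_subset[OF sub]
      unfolding non_uniform_def by blast
  qed
  then obtain x where "x \<in> X" "t x \<noteq> 0" by blast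
  then have "sum t X > 0"
    using assms(1) nonneg by (intro sum_pos2[of X x]) (auto simp: less_le)
  then show ?thesis by (simp add: shannon_entropy_def t_def sum_negf)
qed

text \<open>On the support all factors are positive, so the logarithm of their product
  splits.\<close>

lemma log_pmf_replicate_pmf:
  assumes "xs \<in> set_pmf (replicate_pmf n P)"
  shows "log 2 (pmf (replicate_pmf n P) xs) = - sum_list (map (\<lambda>x. - log 2 (pmf P x)) xs)"
proof -
  have "length xs = n" "\<forall>x\<in>set xs. pmf P x > 0"
    using assms by (auto simp: set_replicate_pmf pmf_positive)
  then show ?thesis
    unfolding pmf_replicate_pmf[OF \<open>length xs = n\<close>]
  proof (induction xs arbitrary: n)
    case (Cons x xs)
    have "prod_list (map (pmf P) xs) > 0"
      using Cons.prems(2) by (induction xs) auto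
    then show ?case using Cons by (simp add: log_mult)
  qed simp
qed

text \<open>A word has probability at least \<open>c n\<close> iff its information content, a sum of
  \<open>n\<close> independent terms, is at most \<open>- log 2 (c n)\<close>. After normalization
  this is the central limit theorem at a threshold converging to
  \<open>a / sqrt (varentropy X P)\<close>.\<close>

lemma prob_pmf_ge_tendsto:
  assumes "finite X" "P \<in> dists X" "non_uniform P"
    and pos: "eventually (\<lambda>n. c n > 0) sequentially"
    and lim: "(\<lambda>n. (- log 2 (c n) - n * shannon_entropy X P) / sqrt n) \<longlonglongrightarrow> a"
  shows "(\<lambda>n. measure_pmf.prob (replicate_pmf n P) {xs. c n \<le> pmf (replicate_pmf n P) xs})
    \<longlonglongrightarrow> Phi (a / sqrt (varentropy X P))"
proof -
  define H where "H = shannon_entropy X P"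
  define V where "V = varentropy X P"
  define i where "i xs = sum_list (map (\<lambda>x. - log 2 (pmf P x)) xs)" for xs
  define G where "G n x = measure_pmf.prob (replicate_pmf n P) {xs. (i xs - n * H) / sqrt (n * V) \<le> x}" for n x
  have V: "V > 0" unfolding V_def by (rule varentropy_pos[OF assms(1-3)])
  have fin: "finite (set_pmf P)"
    using assms(1,2) finite_subset by (auto simp: dists_def)
  have clt: "weak_conv_m
    (\<lambda>n. distr (measure_pmf (replicate_pmf n P)) borel (\<lambda>xs. (i xs - n * H) / sqrt (n * V)))
    std_normal_distribution"
    using replicate_pmf_central_limit[OF fin, of "\<lambda>x. - log 2 (pmf P x)"] V
    unfolding H_def V_def i_def shannon_entropy_eq_expectation[OF assms(1,2)]
      varentropy_eq_variance[OF assms(1,2)] by blast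
  have "cdf (distr (measure_pmf (replicate_pmf n P)) borel (\<lambda>xs. (i xs - n * H) / sqrt (n * V))) x = G n x"
    for n x
    unfolding cdf_def G_def by (subst measure_distr) (auto simp: vimage_def)
  then have G: "(\<lambda>n. G n x) \<longlonglongrightarrow> Phi x" for x
    using clt isCont_Phi[of x] unfolding weak_conv_m_def weak_conv_def Phi_def by simp
  have mono: "mono (G n)" for n
    unfolding G_def by (intro monoI measure_pmf.finite_measure_mono) auto
  have "(\<lambda>n. (- log 2 (c n) - n * H) / sqrt n / sqrt V) \<longlonglongrightarrow> a / sqrt V"
    using lim V unfolding H_def by (intro tendsto_divide) auto
  then have "(\<lambda>n. G n ((- log 2 (c n) - n * H) / sqrt n / sqrt V)) \<longlonglongrightarrow> Phi (a / sqrt V)"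
    by (rule tendsto_moving_point[where G = Phi, OF mono G isCont_Phi])
  moreover have "eventually (\<lambda>n. G n ((- log 2 (c n) - n * H) / sqrt n / sqrt V) =
     measure_pmf.prob (replicate_pmf n P) {xs. c n \<le> pmf (replicate_pmf n P) xs}) sequentially"
    using pos eventually_gt_at_top[of 0]
  proof eventually_elim
    case (elim n)
    \<comment> \<open>The two events agree only almost surely: off the support,
      \<open>log 2 0 = 0\<close> gives \<open>i\<close> a finite value although the word has
      probability 0.\<close>
    have "(i xs - n * H) / sqrt (n * V) \<le> (- log 2 (c n) - n * H) / sqrt n / sqrt V
        \<longleftrightarrow> c n \<le> pmf (replicate_pmf n P) xs"
      if "xs \<in> set_pmf (replicate_pmf n P)" for xs
    proof -
      have "sqrt (n * V) > 0" using elim V by simp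
      then have "(i xs - n * H) / sqrt (n * V) \<le> (- log 2 (c n) - n * H) / sqrt n / sqrt V
          \<longleftrightarrow> log 2 (c n) \<le> - i xs"
        by (simp add: divide_le_cancel flip: real_sqrt_mult divide_divide_eq_left') linarith
      also have "\<dots> \<longleftrightarrow> log 2 (c n) \<le> log 2 (pmf (replicate_pmf n P) xs)"
        by (simp only: log_pmf_replicate_pmf[OF that] i_def)
      also have "\<dots> \<longleftrightarrow> c n \<le> pmf (replicate_pmf n P) xs"
        using elim pmf_positive[OF that] by simp
      finally show ?thesis .
    qed
    then show ?case
      unfolding G_def by (intro measure_pmf.finite_measure_eq_AE) (auto simp: AE_measure_pmf_iff)
  qed
  ultimately show ?thesis
    unfolding V_def by (rule Lim_transform_eventually)
qed

section \<open>Asymptotic fidelity\<close>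

text \<open>Once \<open>y n\<close> is nonnegative, rounding changes it by at most 1, which vanishes
  after division by \<open>sqrt n\<close>.\<close>

lemma rounded_exponent_tendsto:
  fixes H L t :: real
  assumes "H > 0" "L > 0"
  defines "y \<equiv> \<lambda>n. H / L * real n + t * sqrt (real n)"
  shows "eventually (\<lambda>n. 0 \<le> y n) sequentially"
    and "(\<lambda>n. (real (nat \<lfloor>y n\<rfloor>) * L - n * H) / sqrt n) \<longlonglongrightarrow> L * t"
proof -
  have "filterlim y at_top sequentially"
    unfolding y_def using assms(1,2) by real_asymp
  then show ev: "eventually (\<lambda>n. 0 \<le> y n) sequentially"
    by (simp add: filterlim_at_top)
  have "(\<lambda>n. (real (nat \<lfloor>y n\<rfloor>) * L - n * H) / sqrt n - L * t) \<longlonglongrightarrow> 0"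
  proof (rule Lim_null_comparison)
    show "eventually (\<lambda>n. norm ((real (nat \<lfloor>y n\<rfloor>) * L - n * H) / sqrt n - L * t) \<le> L / sqrt n) sequentially"
      using ev eventually_gt_at_top[of 0]
    proof eventually_elim
      case (elim n)
      have "(real (nat \<lfloor>y n\<rfloor>) * L - n * H) / sqrt n - L * t = (real (nat \<lfloor>y n\<rfloor>) - y n) * L / sqrt n"
        using elim assms(2) by (simp add: y_def field_simps)
      moreover have "\<bar>real (nat \<lfloor>y n\<rfloor>) - y n\<bar> \<le> 1"
        using elim by linarith
      then have "\<bar>real (nat \<lfloor>y n\<rfloor>) - y n\<bar> * L / sqrt n \<le> 1 * L / sqrt n"
        using assms(2) by (intro divide_right_mono mult_right_mono) auto
      ultimately show ?case using assms(2) by (simp add: abs_mult)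
    qed
    show "(\<lambda>n. L / sqrt (real n)) \<longlonglongrightarrow> 0" by real_asymp
  qed
  then show "(\<lambda>n. (real (nat \<lfloor>y n\<rfloor>) * L - n * H) / sqrt n) \<longlonglongrightarrow> L * t"
    by (rule LIM_zero_cancel)
qed

lemma card_storage: "card (storage N) = nat \<lfloor>2 powr N\<rfloor>"
  by (simp add: storage_def)

text \<open>In both cases \<open>FD n <= FM n\<close> holds eventually, and a lower bound for
  \<open>FD\<close> and an upper bound for \<open>FM\<close> have the same limit. Hence both
  sequences converge, and not merely their lower limits agree.\<close>

lemma uniform_fidelity_tendsto:
  fixes X :: "'a set" and P :: "'a pmf" and Y :: "'b set" and s t :: real
  assumes X: "finite X" "P \<in> dists X" "non_uniform P"
    and Y: "finite Y" "card Y \<ge> 2"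
  defines "L \<equiv> log 2 (real (card Y))"
    and "H \<equiv> shannon_entropy X P"
    and "V \<equiv> varentropy X P"
    and "U \<equiv> pmf_of_set Y"
  defines "m \<equiv> \<lambda>n. nat \<lfloor>H / L * real n + t * sqrt (real n)\<rfloor>"
    and "N \<equiv> \<lambda>n. H * real n + s * sqrt (real n)"
  defines "FD \<equiv> \<lambda>n. fidelity_det (words X n) (replicate_pmf n P) (words Y (m n)) (replicate_pmf (m n) U) (N n)"
    and "FM \<equiv> \<lambda>n. fidelity_maj (words X n) (replicate_pmf n P) (words Y (m n)) (replicate_pmf (m n) U) (N n)"
  defines "F \<equiv> (if L * t \<le> s then sqrt (Phi (- (L / sqrt V * t))) else 0)"
  shows "FD \<longlonglongrightarrow> F" and "FM \<longlonglongrightarrow> F"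
proof -
  define M where "M n = real (card (words Y (m n)))" for n
  define K where "K n = card (storage (N n))" for n
  have L: "L > 0" using Y by (simp add: L_def)
  have H: "H > 0" unfolding H_def by (rule shannon_entropy_pos[OF X])
  have Yne: "Y \<noteq> {}" using Y by auto
  \<comment> \<open>As a power of 2, the target size is compared with the storage and with the
    thresholds through exponents.\<close>
  have M: "M n = 2 powr (m n * L)" for n
  proof -
    have "M n = (2 powr L) powr (m n)"
      unfolding M_def card_words[OF Y(1)] using Y Yne by (simp add: L_def powr_realpow)
    then show ?thesis by (simp add: powr_powr mult.commute)
  qed
  have Mpos: "M n > 0" for n by (simp add: M)
  have U: "replicate_pmf k U = pmf_of_set (words Y k)" for k
    unfolding U_def by (rule replicate_pmf_of_set[OF Y(1) Yne])
  have WX: "finite (words X n)" for n by (rule finite_words[OF X(1)])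
  have WY: "finite (words Y n)" for n by (rule finite_words[OF Y(1)])
  have WYne: "words Y (m n) \<noteq> {}" for n using Mpos[of n] by (auto simp: M_def)
  have RP: "replicate_pmf n P \<in> dists (words X n)" for n by (rule replicate_pmf_in_dists[OF X(2)])

  have "filterlim N at_top sequentially" unfolding N_def using H by real_asymp
  then have Npos: "eventually (\<lambda>n. N n \<ge> 0) sequentially" by (simp add: filterlim_at_top)
  have stne: "storage (N n) \<noteq> {}" if "N n \<ge> 0" for n
  proof -
    have "2 powr N n \<ge> 1" using that by (simp add: ge_one_powr_ge_zero)
    then show ?thesis by (simp add: storage_def lessThan_empty_iff)
  qed
  have ev_y: "eventually (\<lambda>n. 0 \<le> H / L * real n + t * sqrt (real n)) sequentially"
    and lim_m: "(\<lambda>n. (real (m n) * L - n * H) / sqrt n) \<longlonglongrightarrow> L * t"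
    unfolding m_def using rounded_exponent_tendsto[OF H L] by auto
  have le: "eventually (\<lambda>n. FD n \<le> FM n) sequentially"
    using Npos
  proof eventually_elim
    case (elim n)
    then show ?case unfolding FD_def FM_def by (intro fidelity_det_le_maj WX WY RP WYne stne)
  qed
  have "FD \<longlonglongrightarrow> F \<and> FM \<longlonglongrightarrow> F"
  proof (cases "L * t \<le> s")
    case True
    have log_lim: "(\<lambda>n. ln (real n) / ln 2 / sqrt (real n)) \<longlonglongrightarrow> 0" by real_asymp
    \<comment> \<open>\<open>B n\<close> holds the heavy words, and the words outside
      \<open>C n\<close> are the light ones. The factor \<open>n\<close> makes both the share of the
      target occupied by the heavy words and the total binning overshoot at most
      \<open>1 / n\<close>.\<close>
    define B where "B n = {xs. n / M n \<le> pmf (replicate_pmf n P) xs}" for n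
    define C where "C n = {xs. 1 / (n * M n) \<le> pmf (replicate_pmf n P) xs}" for n
    have "(\<lambda>n. (- log 2 (n / M n) - n * H) / sqrt n) \<longlonglongrightarrow> L * t - 0"
    proof (rule Lim_transform_eventually[OF tendsto_diff[OF lim_m log_lim]])
      show "eventually (\<lambda>n. (real (m n) * L - n * H) / sqrt n - ln (real n) / ln 2 / sqrt (real n)
        = (- log 2 (n / M n) - n * H) / sqrt n) sequentially"
        using eventually_gt_at_top[of 0]
      proof eventually_elim
        case (elim n)
        then have "log 2 (n / M n) = ln (real n) / ln 2 - m n * L"
          by (simp add: M log_divide) (simp add: log_def)
        then show ?case by (simp add: diff_divide_distrib)
      qed
    qed
    then have B_lim: "(\<lambda>n. measure_pmf.prob (replicate_pmf n P) (B n)) \<longlonglongrightarrow> Phi (L * t / sqrt V)"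
      unfolding B_def V_def
      by (intro prob_pmf_ge_tendsto[OF X])
         (auto simp: H_def Mpos intro!: eventually_mono[OF eventually_gt_at_top[of 0]])
    have "(\<lambda>n. (- log 2 (1 / (n * M n)) - n * H) / sqrt n) \<longlonglongrightarrow> L * t + 0"
    proof (rule Lim_transform_eventually[OF tendsto_add[OF lim_m log_lim]])
      show "eventually (\<lambda>n. (real (m n) * L - n * H) / sqrt n + ln (real n) / ln 2 / sqrt (real n)
        = (- log 2 (1 / (n * M n)) - n * H) / sqrt n) sequentially"
        using eventually_gt_at_top[of 0]
      proof eventually_elim
        case (elim n)
        then have "log 2 (1 / (n * M n)) = - (ln (real n) / ln 2) - m n * L"
          by (simp add: M log_divide log_mult) (simp add: log_def)
        then show ?case by (simp add: diff_divide_distrib add_divide_distrib)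
      qed
    qed
    then have C_lim: "(\<lambda>n. measure_pmf.prob (replicate_pmf n P) (C n)) \<longlonglongrightarrow> Phi (L * t / sqrt V)"
      unfolding C_def V_def
      by (intro prob_pmf_ge_tendsto[OF X])
         (auto simp: H_def Mpos intro!: eventually_mono[OF eventually_gt_at_top[of 0]])
    have inv_lim: "(\<lambda>n. 1 / real n) \<longlonglongrightarrow> 0" by real_asymp
    have lim_eq: "F = sqrt (1 - Phi (L * t / sqrt V))"
      using True by (simp add: F_def Phi_minus)

    have upper: "eventually (\<lambda>n. FM n \<le> sqrt (1 / n) + sqrt (1 - measure_pmf.prob (replicate_pmf n P) (B n))) sequentially"
      using Npos eventually_gt_at_top[of 0]
    proof eventually_elim
      case (elim n)
      have B_words: "measure_pmf.prob (replicate_pmf n P) (B n \<inter> words X n) = measure_pmf.prob (replicate_pmf n P) (B n)"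
        using RP[of n] by (intro measure_pmf.finite_measure_eq_AE) (auto simp: AE_measure_pmf_iff dists_def)
      have "real (card (B n \<inter> words X n)) * (n / M n) \<le> 1"
        using WX[of n] by (intro card_mult_le_1_if_pmf_ge[where P = "replicate_pmf n P"]) (auto simp: B_def)
      then have "real (card (B n \<inter> words X n)) / M n \<le> 1 / n"
        using elim Mpos[of n] by (simp add: field_simps)
      then have "sqrt (real (card (B n \<inter> words X n)) / M n) \<le> sqrt (1 / n)"
        by (rule real_sqrt_le_mono)
      moreover have "FM n \<le> sqrt (real (card (B n \<inter> words X n)) / M n)
          + sqrt (1 - measure_pmf.prob (replicate_pmf n P) (B n \<inter> words X n))"
        unfolding FM_def U M_def using elim by (intro fidelity_maj_le_prob WX WY RP WYne stne) auto
      ultimately show ?case unfolding B_words by linarith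
    qed

    \<comment> \<open>Rounding \<open>m n\<close> down only shrinks the target, and an integer
      bounded by \<open>2 powr N n\<close> is also bounded by its floor.\<close>
    have storage: "eventually (\<lambda>n. card (words Y (m n)) \<le> K n) sequentially"
      using ev_y
    proof eventually_elim
      case (elim n)
      have "m n * L \<le> (H / L * real n + t * sqrt (real n)) * L"
        using elim L unfolding m_def by (intro mult_right_mono) auto
      also have "\<dots> = H * n + L * t * sqrt n" using L by (simp add: field_simps)
      also have "\<dots> \<le> N n" unfolding N_def using True by (intro add_left_mono mult_right_mono) auto
      finally have "M n \<le> 2 powr N n" by (simp add: M)
      then show ?case unfolding M_def K_def card_storage by (simp add: le_nat_floor)
    qed
    have lower: "eventually (\<lambda>n. sqrt (1 - measure_pmf.prob (replicate_pmf n P) (C n) - 1 / n) \<le> FD n) sequentially"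
      using storage eventually_gt_at_top[of 0]
    proof eventually_elim
      case (elim n)
      have "1 - measure_pmf.prob (replicate_pmf n P) (C n) = measure_pmf.prob (replicate_pmf n P) (UNIV - C n)"
        using measure_pmf.prob_compl[of "C n" "replicate_pmf n P"] by simp
      also have "\<dots> = measure_pmf.prob (replicate_pmf n P) (words X n - C n)"
        using RP[of n] by (intro measure_pmf.finite_measure_eq_AE) (auto simp: AE_measure_pmf_iff dists_def)
      finally have C: "1 - measure_pmf.prob (replicate_pmf n P) (C n)
        = measure_pmf.prob (replicate_pmf n P) (words X n - C n)" .
      show ?case
        unfolding C FD_def U
        by (rule fidelity_det_ge_prob[OF WX RP WY WYne])
           (use elim in \<open>auto simp: C_def K_def M_def\<close>)
    qed
    have lower_lim: "(\<lambda>n. sqrt (1 - measure_pmf.prob (replicate_pmf n P) (C n) - 1 / n)) \<longlonglongrightarrow> F"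
      unfolding lim_eq using tendsto_real_sqrt[OF tendsto_diff[OF tendsto_diff[OF tendsto_const C_lim] inv_lim], of 1] by simp
    have upper_lim: "(\<lambda>n. sqrt (1 / n) + sqrt (1 - measure_pmf.prob (replicate_pmf n P) (B n))) \<longlonglongrightarrow> F"
      unfolding lim_eq
      using tendsto_add[OF tendsto_real_sqrt[OF inv_lim] tendsto_real_sqrt[OF tendsto_diff[OF tendsto_const B_lim]], of 1] by simp
    have "FD \<longlonglongrightarrow> F"
      by (rule tendsto_sandwich[OF lower _ lower_lim upper_lim])
         (use le upper in eventually_elim, linarith)
    moreover have "FM \<longlonglongrightarrow> F"
      by (rule tendsto_sandwich[OF _ upper lower_lim upper_lim])
         (use le lower in eventually_elim, linarith)
    ultimately show ?thesis by blast
  next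
    case False
    \<comment> \<open>This bounds the square root of storage size over target size: rounding
      \<open>m n\<close> costs at most a factor \<open>2 powr L\<close>, and the second-order gap
      gives the exponent with negative coefficient \<open>s - L * t\<close>.\<close>
    define u where "u n = sqrt (2 powr (L + (s - L * t) * sqrt (real n)))" for n :: nat
    have u_lim: "u \<longlonglongrightarrow> 0"
    proof -
      have "filterlim (\<lambda>n. L + c * sqrt (real n)) at_bot sequentially" if "c < 0" for c
        using that by real_asymp
      then have "filterlim (\<lambda>n. L + (s - L * t) * sqrt (real n)) at_bot sequentially"
        using False by simp
      moreover have "((\<lambda>x::real. sqrt (2 powr x)) \<longlongrightarrow> 0) at_bot"
        by real_asymp
      ultimately show ?thesis
        unfolding u_def by (rule filterlim_compose[rotated])
    qed
    have upper: "eventually (\<lambda>n. FM n \<le> u n) sequentially"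
      using Npos ev_y
    proof eventually_elim
      case (elim n)
      have "(H / L * real n + t * sqrt (real n) - 1) * L \<le> m n * L"
        using elim L unfolding m_def by (intro mult_right_mono) linarith+
      moreover have "(H / L * real n + t * sqrt (real n) - 1) * L = H * n + L * t * sqrt n - L"
        using L by (simp add: field_simps)
      ultimately have "N n - m n * L \<le> L + (s - L * t) * sqrt n"
        by (simp add: N_def algebra_simps)
      then have "2 powr N n / M n \<le> 2 powr (L + (s - L * t) * sqrt n)"
        by (simp add: M flip: powr_diff)
      moreover have "real (K n) \<le> 2 powr N n"
        unfolding K_def card_storage by simp
      then have "real (K n) / M n \<le> 2 powr N n / M n"
        using Mpos[of n] by (intro divide_right_mono) auto
      ultimately have "sqrt (real (K n) / M n) \<le> u n" unfolding u_def by simp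
      moreover have "FM n \<le> sqrt (real (K n) / M n)"
        unfolding FM_def U M_def K_def using elim by (intro fidelity_maj_le_storage WX WY RP WYne stne) auto
      ultimately show ?case by linarith
    qed
    have lower: "eventually (\<lambda>n. 0 \<le> FD n) sequentially"
      using Npos
    proof eventually_elim
      case (elim n)
      then show ?case unfolding FD_def by (intro fidelity_det_nonneg WY WYne stne)
    qed
    have "FD \<longlonglongrightarrow> 0"
      by (rule tendsto_sandwich[OF lower _ tendsto_const u_lim])
         (use le upper in eventually_elim, linarith)
    moreover have "FM \<longlonglongrightarrow> 0"
      by (rule tendsto_sandwich[OF _ upper tendsto_const u_lim])
         (use le lower in eventually_elim, linarith)
    ultimately show ?thesis using False by (simp add: F_def)
  qed
  then show "FD \<longlonglongrightarrow> F" "FM \<longlonglongrightarrow> F" by auto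
qed

theorem theorem29:
  fixes X :: "'a set" and P :: "'a pmf" and Y :: "'b set" and l :: nat and s t :: real
  assumes "finite X" and "P \<in> dists X" and "non_uniform P"
    and "finite Y" and "card Y = l" and "l \<ge> 2"
  shows "second_order_fidelity fidelity_det X P Y (pmf_of_set Y) s t =
           second_order_fidelity fidelity_maj X P Y (pmf_of_set Y) s t
       \<and> second_order_fidelity fidelity_det X P Y (pmf_of_set Y) s t =
           ereal (if log 2 (real l) * t \<le> s
                  then sqrt (Phi (- log 2 (real l) / sqrt (varentropy X P) * t)) else 0)
       \<and> second_order_fidelity fidelity_det X P Y (pmf_of_set Y) s t =
           ereal (sqrt (1 - Z0 (s / sqrt (varentropy X P)) (t * D_ratio X P Y (pmf_of_set Y))))"
proof -
  have Y: "Y \<noteq> {}" "card Y \<ge> 2" using assms by auto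
  have entropy: "shannon_entropy Y (pmf_of_set Y) = log 2 l"
    using shannon_entropy_pmf_of_set[OF assms(4) Y(1)] assms by simp
  have V: "sqrt (varentropy X P) > 0" using varentropy_pos[OF assms(1-3)] by simp
  let ?lim = "if log 2 (real l) * t \<le> s
    then sqrt (Phi (- (log 2 (real l) / sqrt (varentropy X P) * t))) else 0"
  have "second_order_fidelity fidelity_det X P Y (pmf_of_set Y) s t = ereal ?lim"
    and "second_order_fidelity fidelity_maj X P Y (pmf_of_set Y) s t = ereal ?lim"
    using uniform_fidelity_tendsto[OF assms(1-4) Y(2), where s = s and t = t, THEN tendsto_ereal]
    unfolding second_order_fidelity_def Let_def entropy assms(5)
    by (auto intro!: lim_imp_Liminf)
  \<comment> \<open>Dividing by the positive \<open>sqrt (varentropy X P)\<close> turns the case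
    condition into that of \<open>Z0\<close>. Its value 1 gives fidelity 0, and otherwise
    \<open>Phi_minus\<close> applies.\<close>
  moreover have "sqrt (1 - Z0 (s / sqrt (varentropy X P)) (t * D_ratio X P Y (pmf_of_set Y))) = ?lim"
    using V by (simp add: Z0_def D_ratio_def entropy Phi_minus divide_le_cancel mult.commute)
  ultimately show ?thesis by simp
qed

end
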